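(* Let $F$ be a field and let $A_1,\dots,A_n$ be subsets of $F$, none of which is a singleton, each of which is a coset $cH$ (with $c\in F^*$) of some finite multiplicative subgroup $H$ of $F^*$ (the subgroups may differ for different $i$). Assume that a polynomial $f\in F[X_1,\dots,X_n]$ contains a monomial $X_1^{k_1}\cdots X_n^{k_n}$ with non-zero coefficient, such that $k_1<|A_1|,\dots,k_n<|A_n|$ and \[\deg(f)\leq k_1+\dots+k_n+\min\{|A_1|,\dots,|A_n|\}-1.\] Then $f(a)\neq 0$ for some grid point $a\in A_1\times\dots\times A_n$.
   Context: $\deg(f)$ denotes the total degree of $f$. *)

theory Defs
  imports "HOL-Library.Poly_Mapping" "HOL-Algebra.Algebraic_Closure_Type"
begin

text \<open>
  Polynomials are finitely supported maps from exponent vectors to coefficients, with the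
  ring structure of \<^theory>\<open>HOL-Library.Poly_Mapping\<close>. The variables \<open>X\<^sub>1, \<dots>, X\<^sub>n\<close> are
  indexed by a finite type \<open>'n\<close> with \<open>n = CARD('n) \<ge> 1\<close>.
\<close>

type_synonym ('n, 'a) mpoly = "('n \<Rightarrow>\<^sub>0 nat) \<Rightarrow>\<^sub>0 'a"

definition mpoly_eval :: "('n::finite, 'a::comm_semiring_1) mpoly \<Rightarrow> ('n \<Rightarrow> 'a) \<Rightarrow> 'a" where
  "mpoly_eval f a =
     (\<Sum>m\<in>Poly_Mapping.keys f.
        Poly_Mapping.lookup f m * (\<Prod>i\<in>UNIV. a i ^ Poly_Mapping.lookup m i))"

text \<open>The \<open>insert 0\<close> only matters for the zero polynomial, which gets degree 0.\<close>

definition mpoly_deg :: "('n::finite, 'a::zero) mpoly \<Rightarrow> nat" where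
  "mpoly_deg f =
     Max (insert 0 ((\<lambda>m. \<Sum>i\<in>UNIV. Poly_Mapping.lookup m i) ` Poly_Mapping.keys f))"

text \<open>
  The multiplicative group of the field \<open>'a\<close>, with carrier \<open>UNIV - {0}\<close>. The name is qualified
  because HOL-Algebra defines a second constant \<open>mult_of\<close> in \<open>Ring_Divisibility\<close>,
  while the group lemmas are about this one.
\<close>

abbreviation field_units :: "'a::field monoid" where
  "field_units \<equiv> Multiplicative_Group.mult_of ring_of_type_algebra"

definition finite_subgroup_coset :: "'a::field set \<Rightarrow> bool" where
  "finite_subgroup_coset A \<longleftrightarrow>
     (\<exists>H c. subgroup H field_units \<and> finite H \<and> c \<in> carrier field_units \<and>
            A = c <#\<^bsub>field_units\<^esub> H)"

end

theory Submission
  imports Defs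
begin

text \<open>
  Weight the values of \<open>f\<close> on the grid by \<open>\<Prod>i. a i ^ (|A i| - k i)\<close> and sum them. The power sum
  \<open>\<Sum>a\<in>A i. a ^ j\<close> vanishes unless \<open>|A i|\<close> divides \<open>j\<close>, and does not vanish if it does. So
  the only monomials of \<open>f\<close> contributing to the weighted sum have exponents congruent to \<open>k i\<close>
  modulo \<open>|A i|\<close> for all \<open>i\<close>, and the degree bound leaves only the monomial with exponents \<open>k\<close>.
  The weighted sum is therefore non-zero, hence so is some value of \<open>f\<close> on the grid.
\<close>

text \<open>These conditions make \<open>H\<close> a finite subgroup of the multiplicative group: by
  finiteness, closure under products yields inverses.\<close>

context
  fixes H :: "'a::field set"
  assumes finite: "finite H" and zero: "0 \<notin> H" and one: "1 \<in> H"
    and mult: "\<And>x y. x \<in> H \<Longrightarrow> y \<in> H \<Longrightarrow> x * y \<in> H"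
begin

lemma bij_betw_mult:
  assumes "g \<in> H"
  shows "bij_betw ((*) g) H H"
proof -
  have "inj_on ((*) g) H"
    using assms zero by (auto simp: inj_on_def)
  moreover have "(*) g ` H \<subseteq> H"
    using assms mult by auto
  ultimately show ?thesis
    using finite by (simp add: bij_betw_def endo_inj_surj)
qed

lemma power_card_eq_1:
  assumes "g \<in> H"
  shows "g ^ card H = 1"
proof -
  have "\<Prod>H = (\<Prod>x\<in>H. g * x)"
    using prod.reindex_bij_betw[OF bij_betw_mult[OF assms], of "\<lambda>x. x"] by simp
  also have "\<dots> = g ^ card H * \<Prod>H"
    by (simp add: prod.distrib)
  finally show ?thesis
    using finite zero by simp
qed

lemma power_eq_1_if_card_dvd:
  assumes "g \<in> H" "card H dvd m"
  shows "g ^ m = 1"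
  using assms by (auto simp: power_mult power_card_eq_1)

text \<open>Multiplication by some \<open>g\<close> in \<open>H\<close> with
  \<open>g ^ m \<noteq> 1\<close> permutes \<open>H\<close> but scales the sum by
  \<open>g ^ m\<close>, so the sum is zero.\<close>

lemma sum_power_eq_0:
  assumes m: "\<not> card H dvd m"
  shows "(\<Sum>x\<in>H. x ^ m) = 0"
proof -
  define r where "r = m mod card H"
  have "r > 0"
    using m by (simp add: r_def mod_greater_zero_iff_not_dvd)
  have pow: "x ^ m = x ^ r" if "x \<in> H" for x
  proof -
    have "x ^ m = x ^ (card H * (m div card H) + r)"
      by (simp add: r_def)
    also have "\<dots> = x ^ r"
      by (simp only: power_add power_mult power_card_eq_1[OF that] power_one mult_1)
    finally show ?thesis .
  qed
  \<comment> \<open>Otherwise all of \<open>H\<close> would be roots of \<open>X ^ r - 1\<close>, a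
    non-zero polynomial of degree less than \<open>card H\<close>; this is why \<open>m\<close> was
    reduced to \<open>r\<close>.\<close>
  have "\<exists>g\<in>H. g ^ m \<noteq> 1"
  proof (rule ccontr)
    assume *: "\<not> ?thesis"
    define p :: "'a poly" where "p = monom 1 r - 1"
    have "coeff p r = 1"
      using \<open>r > 0\<close> by (simp add: p_def)
    then have "p \<noteq> 0" by auto
    have "degree p \<le> r"
      unfolding p_def by (rule degree_diff_le) (auto simp: degree_monom_le)
    have "H \<subseteq> {x. poly p x = 0}"
      using * pow by (auto simp: p_def poly_monom)
    then have "card H \<le> card {x. poly p x = 0}"
      by (intro card_mono poly_roots_finite \<open>p \<noteq> 0\<close>)
    also have "\<dots> \<le> r"
      using card_poly_roots_bound[OF \<open>p \<noteq> 0\<close>] \<open>degree p \<le> r\<close> by linarith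
    finally have "card H \<le> r" .
    moreover have "card H > 0"
      using finite one by (auto simp: card_gt_0_iff)
    ultimately show False
      unfolding r_def by (metis leD mod_less_divisor)
  qed
  then obtain g where g: "g \<in> H" "g ^ m \<noteq> 1" by blast
  have "(\<Sum>x\<in>H. x ^ m) = (\<Sum>x\<in>H. (g * x) ^ m)"
    using sum.reindex_bij_betw[OF bij_betw_mult[OF g(1)], of "\<lambda>x. x ^ m"] by simp
  also have "\<dots> = g ^ m * (\<Sum>x\<in>H. x ^ m)"
    by (simp add: power_mult_distrib sum_distrib_left)
  finally show ?thesis
    using g(2) by simp
qed

lemma sum_power_if_card_dvd:
  assumes "card H dvd m"
  shows "(\<Sum>x\<in>H. x ^ m) = of_nat (card H)"
  using assms by (simp add: power_eq_1_if_card_dvd)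

text \<open>
  If \<open>|H| = 0\<close> in the field, then all power sums over \<open>H\<close> vanish, hence so does the sum over \<open>H\<close>
  of the values of any polynomial, such as one that vanishes on \<open>H\<close> except at \<open>1\<close>.
\<close>
lemma of_nat_card_neq_0: "(of_nat (card H) :: 'a) \<noteq> 0"
proof
  assume "(of_nat (card H) :: 'a) = 0"
  then have power_sum: "(\<Sum>x\<in>H. x ^ m) = 0" for m
    by (cases "card H dvd m") (simp_all add: sum_power_eq_0 sum_power_if_card_dvd)
  define p where "p = (\<Prod>g\<in>H - {1}. [:- g, 1:])"
  have "(\<Sum>x\<in>H. poly p x) = (\<Sum>i\<le>degree p. coeff p i * (\<Sum>x\<in>H. x ^ i))"
    unfolding poly_altdef sum_distrib_left by (rule sum.swap)
  then have "(\<Sum>x\<in>H. poly p x) = 0"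
    by (simp add: power_sum)
  moreover have "poly p x = 0" if "x \<in> H - {1}" for x
    using finite that by (auto simp: p_def poly_prod)
  then have "(\<Sum>x\<in>H. poly p x) = poly p 1"
    using finite one by (simp add: sum.remove[of H 1])
  moreover have "poly p 1 \<noteq> 0"
    using finite by (simp add: p_def poly_prod)
  ultimately show False by simp
qed

end

text \<open>Translates from the group record to field operations, in the form that the lemmas on
  \<open>H\<close> expect.\<close>

lemma finite_subgroup_cosetE:
  fixes A :: "'a::field set"
  assumes "finite_subgroup_coset A"
  obtains H c where "finite H" "0 \<notin> H" "1 \<in> H" "\<And>x y. x \<in> H \<Longrightarrow> y \<in> H \<Longrightarrow> x * y \<in> H"
    "c \<noteq> 0" "A = (*) c ` H"
proof -
  obtain H c where H: "subgroup H (field_units :: 'a monoid)" "finite H"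
    "c \<in> carrier (field_units :: 'a monoid)" "A = c <#\<^bsub>field_units\<^esub> H"
    using assms unfolding finite_subgroup_coset_def by blast
  show thesis
  proof (rule that)
    show "x * y \<in> H" if "x \<in> H" "y \<in> H" for x y
      using subgroup.m_closed[OF H(1) that] by (simp add: ring_of_type_algebra_def)
    show "0 \<notin> H" "1 \<in> H"
      using subgroup.subset[OF H(1)] subgroup.one_closed[OF H(1)]
      by (auto simp: ring_of_type_algebra_def)
    show "c \<noteq> 0" "A = (*) c ` H"
      using H(3,4) by (auto simp: ring_of_type_algebra_def l_coset_def)
  qed (rule H(2))
qed

text \<open>Scaling by \<open>c\<close> multiplies the power sum over \<open>H\<close> by
  \<open>c ^ m\<close>, which is non-zero.\<close>

lemma coset_power_sum_eq_0_iff: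
  fixes A :: "'a::field set"
  assumes "finite_subgroup_coset A"
  shows "(\<Sum>x\<in>A. x ^ m) = 0 \<longleftrightarrow> \<not> card A dvd m"
proof -
  obtain H c where H: "finite H" "0 \<notin> H" "1 \<in> H" "\<And>x y. x \<in> H \<Longrightarrow> y \<in> H \<Longrightarrow> x * y \<in> H"
    and c: "c \<noteq> 0" "A = (*) c ` H"
    using finite_subgroup_cosetE[OF assms] by blast
  have inj: "inj_on ((*) c) H"
    using c(1) by (auto simp: inj_on_def)
  have "(\<Sum>x\<in>A. x ^ m) = c ^ m * (\<Sum>x\<in>H. x ^ m)"
    by (simp add: c(2) sum.reindex[OF inj] power_mult_distrib sum_distrib_left)
  moreover have "card A = card H"
    by (simp add: c(2) card_image[OF inj])
  ultimately show ?thesis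
    using c(1) sum_power_eq_0[OF H] sum_power_if_card_dvd[OF H] of_nat_card_neq_0[OF H]
    by (cases "card H dvd m") simp_all
qed

lemma sum_le_mpoly_deg:
  assumes "m \<in> Poly_Mapping.keys f"
  shows "(\<Sum>i\<in>UNIV. Poly_Mapping.lookup m i) \<le> mpoly_deg f"
  unfolding mpoly_deg_def using assms by (intro Max_ge) auto

text \<open>After exchanging the sums, each monomial is a product of one-variable factors, so its
  sum over the grid factors too.\<close>

lemma sum_mpoly_eval_mult_monomial:
  fixes A :: "'n::finite \<Rightarrow> 'a::comm_semiring_1 set"
  assumes "\<And>i. finite (A i)"
  shows "(\<Sum>a\<in>PiE UNIV A. mpoly_eval f a * (\<Prod>i\<in>UNIV. a i ^ e i)) =
    (\<Sum>m\<in>Poly_Mapping.keys f.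
      Poly_Mapping.lookup f m * (\<Prod>i\<in>UNIV. \<Sum>x\<in>A i. x ^ (Poly_Mapping.lookup m i + e i)))"
proof -
  have "(\<Sum>a\<in>PiE UNIV A. mpoly_eval f a * (\<Prod>i\<in>UNIV. a i ^ e i)) =
    (\<Sum>a\<in>PiE UNIV A. \<Sum>m\<in>Poly_Mapping.keys f.
      Poly_Mapping.lookup f m * (\<Prod>i\<in>UNIV. a i ^ (Poly_Mapping.lookup m i + e i)))"
    by (simp add: mpoly_eval_def sum_distrib_right mult.assoc power_add prod.distrib)
  also have "\<dots> = (\<Sum>m\<in>Poly_Mapping.keys f. Poly_Mapping.lookup f m *
      (\<Sum>a\<in>PiE UNIV A. \<Prod>i\<in>UNIV. a i ^ (Poly_Mapping.lookup m i + e i)))"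
    unfolding sum_distrib_left by (rule sum.swap)
  finally show ?thesis
    using assms by (simp add: prod_sum_PiE)
qed

text \<open>The sum is a positive multiple of \<open>q\<close>: \<open>q\<close> itself gives
  \<open>j = k\<close>, and any larger multiple gives the second case.\<close>

lemma dvd_add_diff_cases:
  fixes j k q :: nat
  assumes "k < q" "q dvd j + (q - k)"
  obtains "j = k" | "j \<ge> k + q"
proof -
  obtain t where t: "j + (q - k) = q * t"
    using assms(2) by blast
  have "t \<noteq> 0"
    using t assms(1) by (cases t) auto
  then consider "t = 1" | "t \<ge> 2" by linarith
  then show thesis
  proof cases
    case 1
    then show thesis using t assms(1) that(1) by simp
  next
    case 2
    then have "q * 2 \<le> q * t" by simp
    then show thesis using t assms(1) that(2) by linarith
  qed
qed

theorem theorem1p3: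
  fixes A :: "'n::finite \<Rightarrow> 'a::field set"
    and f :: "('n, 'a) mpoly"
    and k :: "'n \<Rightarrow>\<^sub>0 nat"
  assumes "\<And>i. \<not> is_singleton (A i)"
    and "\<And>i. finite_subgroup_coset (A i)"
    and "Poly_Mapping.lookup f k \<noteq> 0"
    and "\<And>i. Poly_Mapping.lookup k i < card (A i)"
    and "mpoly_deg f \<le> (\<Sum>i\<in>UNIV. Poly_Mapping.lookup k i) + (MIN i. card (A i)) - 1"
  shows "\<exists>a. (\<forall>i. a i \<in> A i) \<and> mpoly_eval f a \<noteq> 0"
proof (rule ccontr)
  assume contra: "\<not> ?thesis"
  define e where "e = (\<lambda>i. card (A i) - Poly_Mapping.lookup k i)"
  define P where "P = (\<lambda>m. \<Prod>i\<in>UNIV. \<Sum>x\<in>A i. x ^ (Poly_Mapping.lookup m i + e i))"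
  have P_eq_0_iff: "P m = 0 \<longleftrightarrow> (\<exists>i. \<not> card (A i) dvd Poly_Mapping.lookup m i + e i)" for m
    by (simp add: P_def coset_power_sum_eq_0_iff[OF assms(2)])
  have card_pos: "card (A i) > 0" for i
    using assms(4)[of i] by linarith
  have "P m = 0" if m: "m \<in> Poly_Mapping.keys f - {k}" for m
  proof (rule ccontr)
    assume "P m \<noteq> 0"
    then have dvd: "card (A i) dvd Poly_Mapping.lookup m i + (card (A i) - Poly_Mapping.lookup k i)" for i
      by (simp add: P_eq_0_iff e_def)
    have ge: "Poly_Mapping.lookup k i \<le> Poly_Mapping.lookup m i" for i
      by (rule dvd_add_diff_cases[OF assms(4) dvd, of i]) auto
    obtain j where "Poly_Mapping.lookup m j \<noteq> Poly_Mapping.lookup k j"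
      using m by (auto simp: poly_mapping_eq_iff fun_eq_iff)
    then have j: "Poly_Mapping.lookup k j + card (A j) \<le> Poly_Mapping.lookup m j"
      using dvd_add_diff_cases[OF assms(4) dvd, of j] by blast
    \<comment> \<open>The jump in coordinate \<open>j\<close> is at least the minimum, and no other
      exponent drops below that of \<open>k\<close>, so the degree of \<open>m\<close> breaks the
      bound.\<close>
    have "(\<Sum>i\<in>UNIV. Poly_Mapping.lookup k i) + (MIN i. card (A i)) \<le>
        (\<Sum>i\<in>UNIV. Poly_Mapping.lookup k i) + card (A j)"
      by simp
    also have "\<dots> = (Poly_Mapping.lookup k j + card (A j)) +
        (\<Sum>i\<in>UNIV - {j}. Poly_Mapping.lookup k i)"
      by (simp add: sum.remove[of UNIV j])
    also have "\<dots> \<le> Poly_Mapping.lookup m j + (\<Sum>i\<in>UNIV - {j}. Poly_Mapping.lookup m i)"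
      by (intro add_mono j sum_mono ge)
    also have "\<dots> = (\<Sum>i\<in>UNIV. Poly_Mapping.lookup m i)"
      by (simp add: sum.remove[of UNIV j])
    also have "\<dots> \<le> mpoly_deg f"
      using m by (intro sum_le_mpoly_deg) simp
    finally have "(\<Sum>i\<in>UNIV. Poly_Mapping.lookup k i) + (MIN i. card (A i)) \<le> mpoly_deg f" .
    \<comment> \<open>Ensures that the truncated \<open>- 1\<close> in the degree bound really
      lowers it.\<close>
    moreover have "(MIN i. card (A i)) > 0"
      using card_pos by simp
    ultimately show False
      using assms(5) by linarith
  qed
  then have "(\<Sum>m\<in>Poly_Mapping.keys f. Poly_Mapping.lookup f m * P m) =
      Poly_Mapping.lookup f k * P k"
    using assms(3) by (simp add: sum.remove[of _ k] in_keys_iff)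
  moreover have "(\<Sum>m\<in>Poly_Mapping.keys f. Poly_Mapping.lookup f m * P m) =
      (\<Sum>a\<in>PiE UNIV A. mpoly_eval f a * (\<Prod>i\<in>UNIV. a i ^ e i))"
    unfolding P_def using card_pos
    by (intro sum_mpoly_eval_mult_monomial[symmetric]) (simp add: card_gt_0_iff)
  moreover have "\<dots> = 0"
    using contra by (intro sum.neutral) auto
  \<comment> \<open>For \<open>k\<close> the shifted exponents are exactly
    \<open>card (A i)\<close>.\<close>
  moreover have "P k \<noteq> 0"
    using assms(4) by (simp add: P_eq_0_iff e_def less_imp_le)
  ultimately show False
    using assms(3) by simp
qed

end
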